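(* Let $s>0$ and let $J:\mathbb{R}\to[0,+\infty)$ be a (measurable) nonnegative symmetric kernel, $J(-z)=J(z)$, for which there exist constants $\mathcal{J}_0>0$, $\mathcal{J}_1>0$ and $R_0>1$ such that $$\int_{|z|\le 1}J(z)|z|^2\,dz\le 2\mathcal{J}_1\quad\text{and}\quad \frac{\mathcal{J}_0}{|z|^{1+2s}}\ge J(z)\mathbf{1}_{\{|z|>1\}}(z)\ge \frac{\mathcal{J}_0^{-1}}{|z|^{1+2s}}\mathbf{1}_{\{|z|\ge R_0\}}(z)\quad\text{for all } z\in\mathbb{R}\setminus\{0\}.$$ Let $u_0:\mathbb{R}\to[0,+\infty)$ be continuous and bounded, and assume that there exist $a>0$ and $b\in\mathbb{R}$ such that $u_0\ge a\,\mathbf{1}_{(-\infty,b]}$. Then there exists a constant $\kappa>0$, depending only on $J$ and $u_0$ (in particular not on $t$), such that the positive solution $u$ of $$\frac{\partial u}{\partial t}(t,x)=\mathcal{D}[u](t,x)\quad (t>0,\ x\in\mathbb{R}),\qquad u(0,x)=u_0(x)\quad (x\in\mathbb{R}),$$ satisfies $$\forall t\in(0,+\infty),\qquad \liminf_{x\to+\infty}x^{2s}u(t,x)\ge \kappa t.$$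
   Context: The operator $\mathcal{D}$ is the diffusion operator with convolution-type kernel $J$, acting in the space variable: $$\mathcal{D}[u](t,x):=\mathrm{P.V.}\int_{\mathbb{R}}[u(t,x-z)-u(t,x)]J(z)\,dz=\lim_{\varepsilon\to0^+}\int_{|z|>\varepsilon}[u(t,x-z)-u(t,x)]J(z)\,dz.$$ A solution of the initial value problem is a function $u$ in $\mathscr{C}^1((0,+\infty),\mathscr{C}(\mathbb{R}))\cap\mathscr{C}([0,+\infty),\mathscr{C}(\mathbb{R}))$ for which $\mathcal{D}[u](t,x)$ is well defined and the equation holds for all $t>0$ and $x\in\mathbb{R}$, and which equals $u_0$ at $t=0$. It is called positive if $u(t,x)>0$ for all $t>0$, $x\in\mathbb{R}$. The notation $\mathbf{1}_A$ denotes the indicator function of the set $A$. *)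

theory Defs
  imports "HOL-Analysis.Analysis"
begin

text \<open>The bound on the second moment near the origin is stated with the nonnegative integral,
  so that it includes finiteness (the Bochner integral of a non-integrable function is 0).\<close>

definition admissible_kernel :: "real \<Rightarrow> (real \<Rightarrow> real) \<Rightarrow> bool" where
  "admissible_kernel s J \<longleftrightarrow>
     J \<in> borel_measurable lebesgue \<and> (\<forall>z. 0 \<le> J z) \<and> (\<forall>z. J (- z) = J z) \<and>
     (\<exists>J0>0. \<exists>J1>0. \<exists>R0>1.
        (\<integral>\<^sup>+z\<in>{z. \<bar>z\<bar> \<le> 1}. ennreal (J z * \<bar>z\<bar>\<^sup>2) \<partial>lebesgue) \<le> ennreal (2 * J1) \<and>
        (\<forall>z. z \<noteq> 0 \<longrightarrow>
           J z * indicator {z. \<bar>z\<bar> > 1} z \<le> J0 / \<bar>z\<bar> powr (1 + 2 * s) \<and>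
           inverse J0 / \<bar>z\<bar> powr (1 + 2 * s) * indicator {z. \<bar>z\<bar> \<ge> R0} z
             \<le> J z * indicator {z. \<bar>z\<bar> > 1} z))"

definition truncated_diffusion :: "(real \<Rightarrow> real) \<Rightarrow> real \<Rightarrow> (real \<Rightarrow> real) \<Rightarrow> real \<Rightarrow> real" where
  "truncated_diffusion J \<epsilon> v x =
     (LINT z:{z. \<bar>z\<bar> > \<epsilon>}|lebesgue. (v (x - z) - v x) * J z)"

text \<open>\<open>diffusion J v x\<close> is meaningful only where \<open>diffusion_well_defined J v x\<close> holds.\<close>

definition diffusion_well_defined :: "(real \<Rightarrow> real) \<Rightarrow> (real \<Rightarrow> real) \<Rightarrow> real \<Rightarrow> bool" where
  "diffusion_well_defined J v x \<longleftrightarrow>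
     (\<forall>\<epsilon>>0. set_integrable lebesgue {z. \<bar>z\<bar> > \<epsilon>} (\<lambda>z. (v (x - z) - v x) * J z)) \<and>
     (\<exists>L. ((\<lambda>\<epsilon>. truncated_diffusion J \<epsilon> v x) \<longlongrightarrow> L) (at_right 0))"

definition diffusion :: "(real \<Rightarrow> real) \<Rightarrow> (real \<Rightarrow> real) \<Rightarrow> real \<Rightarrow> real" where
  "diffusion J v x = Lim (at_right 0) (\<lambda>\<epsilon>. truncated_diffusion J \<epsilon> v x)"

text \<open>The classes of functions that are continuous, respectively continuously differentiable,
  in time with values in the space of continuous functions on the line. No boundedness in space
  is imposed: the latter space carries the topology of locally uniform convergence.\<close>

definition cont_curve :: "real set \<Rightarrow> (real \<Rightarrow> real \<Rightarrow> real) \<Rightarrow> bool" where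
  "cont_curve I f \<longleftrightarrow>
     (\<forall>t\<in>I. continuous_on UNIV (f t) \<and>
        (\<forall>K. compact K \<longrightarrow> uniform_limit K f (f t) (at t within I)))"

text \<open>The set \<open>I\<close> is meant to be open.\<close>

definition C1_curve :: "real set \<Rightarrow> (real \<Rightarrow> real \<Rightarrow> real) \<Rightarrow> bool" where
  "C1_curve I f \<longleftrightarrow>
     cont_curve I f \<and>
     (\<exists>f'. cont_curve I f' \<and>
        (\<forall>t\<in>I. \<forall>K. compact K \<longrightarrow>
           uniform_limit K (\<lambda>h x. (f (t + h) x - f t x) / h) (f' t) (at 0)))"

definition diffusion_solution ::
  "(real \<Rightarrow> real) \<Rightarrow> (real \<Rightarrow> real) \<Rightarrow> (real \<Rightarrow> real \<Rightarrow> real) \<Rightarrow> bool" where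
  "diffusion_solution J u0 u \<longleftrightarrow>
     C1_curve {0<..} u \<and> cont_curve {0..} u \<and>
     (\<forall>t>0. \<forall>x. diffusion_well_defined J (u t) x \<and>
        ((\<lambda>\<tau>. u \<tau> x) has_real_derivative diffusion J (u t) x) (at t)) \<and>
     (\<forall>x. u 0 x = u0 x)"

definition positive_solution ::
  "(real \<Rightarrow> real) \<Rightarrow> (real \<Rightarrow> real) \<Rightarrow> (real \<Rightarrow> real \<Rightarrow> real) \<Rightarrow> bool" where
  "positive_solution J u0 u \<longleftrightarrow> diffusion_solution J u0 u \<and> (\<forall>t>0. \<forall>x. u t x > 0)"

end

theory Submission
  imports Defs
begin

text \<open>The proof compares \<open>u\<close> with multiples of the wide bump \<open>\<phi>(y) = max 0 (1 - ((y - c) / R)\<^sup>2)\<close>.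
  Its second differences are at least \<open>- 2 min 1 ((z / R)\<^sup>2)\<close>, so \<open>\<D>[\<phi>] \<ge> - \<delta>(R)\<close> everywhere with
  \<open>\<delta>(R) \<rightarrow> 0\<close> as \<open>R \<rightarrow> \<infinity>\<close>, and its support is compact, so comparison from below with the
  nonnegative function \<open>u\<close> needs no growth condition on \<open>u\<close>. Bumps placed in \<open>(-\<infinity>, b]\<close> show that
  \<open>u \<ge> a / 2\<close> on some half line \<open>(-\<infinity>, b - R]\<close> throughout the time interval \<open>[0, T]\<close>. Jumps from this
  half line to a neighbourhood of a distant point \<open>X\<close> occur at a rate of order \<open>X powr (- 2 * s)\<close>, which
  lets a bump centred at \<open>X\<close> grow at that rate; the rate does not depend on \<open>T\<close>, since \<open>R\<close> may be
  chosen after \<open>T\<close>.\<close>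

section \<open>Parabolic bumps and their second differences\<close>

definition bump :: "real \<Rightarrow> real \<Rightarrow> real \<Rightarrow> real" where
  "bump c R y = max 0 (1 - ((y - c) / R)\<^sup>2)"

lemma bump_nonneg: "0 \<le> bump c R y"
  and bump_le_1: "bump c R y \<le> 1"
  by (auto simp: bump_def)

lemma bump_center [simp]: "bump c R c = 1"
  by (simp add: bump_def)

lemma continuous_on_bump: "R > 0 \<Longrightarrow> continuous_on A (bump c R)"
  unfolding bump_def by (intro continuous_intros) auto

lemma bump_eq_0:
  assumes "R > 0" "\<bar>y - c\<bar> \<ge> R"
  shows "bump c R y = 0"
proof -
  have "1 \<le> \<bar>(y - c) / R\<bar>"
    using assms by (simp add: field_simps)
  then have "1 \<le> ((y - c) / R)\<^sup>2"
    by (metis one_le_power power2_abs)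
  then show ?thesis by (simp add: bump_def)
qed

text \<open>The parabola before the cut at 0 has second difference exactly
  \<open>- 2 * (z / R)\<^sup>2\<close>. The cut only raises the two outer values, and where the
  middle value is 0 the second difference is nonnegative. The bound \<open>- 2\<close> comes from
  values lying between 0 and 1.\<close>

lemma bump_second_difference:
  assumes "R > 0"
  shows "bump c R (x - z) + bump c R (x + z) - 2 * bump c R x \<ge> - 2 * min 1 ((z / R)\<^sup>2)"
proof (cases "bump c R x = 0")
  case True
  have "0 \<le> min 1 ((z / R)\<^sup>2)" by simp
  then show ?thesis
    using True bump_nonneg[of c R "x - z"] bump_nonneg[of c R "x + z"] by linarith
next
  case False
  then have x: "bump c R x = 1 - ((x - c) / R)\<^sup>2" by (auto simp: bump_def max_def split: if_splits)
  have 1: "bump c R (x - z) + bump c R (x + z) - 2 * bump c R x \<ge> - 2"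
    using bump_nonneg[of c R "x - z"] bump_nonneg[of c R "x + z"] bump_le_1[of c R x] by linarith
  have "((x - z - c) / R)\<^sup>2 + ((x + z - c) / R)\<^sup>2 = 2 * ((x - c) / R)\<^sup>2 + 2 * (z / R)\<^sup>2"
    using assms by (simp add: field_simps power2_eq_square)
  moreover have "bump c R (x - z) \<ge> 1 - ((x - z - c) / R)\<^sup>2"
    "bump c R (x + z) \<ge> 1 - ((x + z - c) / R)\<^sup>2" by (simp_all add: bump_def)
  ultimately have 2: "bump c R (x - z) + bump c R (x + z) - 2 * bump c R x \<ge> - 2 * (z / R)\<^sup>2"
    using x by linarith
  show ?thesis using 1 2 by (simp add: min_def)
qed

section \<open>The diffusion operator on bumps, for symmetric Levy kernels\<close>

locale levy_kernel =
  fixes J :: "real \<Rightarrow> real"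
  assumes measurable: "J \<in> borel_measurable lebesgue"
    and nonneg: "0 \<le> J z"
    and symmetric: "J (- z) = J z"
    and integrable: "integrable lebesgue (\<lambda>z. min 1 (z\<^sup>2) * J z)"
begin

text \<open>Up to sign, half the kernel integral of the bound on second differences of a bump: this
  is the loss rate \<delta>(R), common to all centres and all points.\<close>

definition spread :: "real \<Rightarrow> real" where
  "spread R = (LINT z|lebesgue. min 1 ((z / R)\<^sup>2) * J z)"

lemma measurable_min_square: "(\<lambda>z::real. min 1 ((z / R)\<^sup>2)) \<in> borel_measurable lebesgue"
  by (rule measurable_completion) simp

lemma min_square_le:
  fixes z R :: real
  assumes "R \<ge> 1"
  shows "min 1 ((z / R)\<^sup>2) \<le> min 1 (z\<^sup>2)"
proof -
  have "(z / R)\<^sup>2 = z\<^sup>2 / R\<^sup>2" by (simp add: power_divide)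
  also have "\<dots> \<le> z\<^sup>2 / 1" using assms by (intro divide_left_mono) auto
  finally show ?thesis by auto
qed

lemma integrable_min_square:
  assumes "R \<ge> 1"
  shows "integrable lebesgue (\<lambda>z. min 1 ((z / R)\<^sup>2) * J z)"
proof (rule Bochner_Integration.integrable_bound[OF integrable])
  show "(\<lambda>z. min 1 ((z / R)\<^sup>2) * J z) \<in> borel_measurable lebesgue"
    using measurable measurable_min_square by (intro borel_measurable_times)
  show "AE z in lebesgue. norm (min 1 ((z / R)\<^sup>2) * J z) \<le> norm (min 1 (z\<^sup>2) * J z)"
    using min_square_le[OF assms] nonneg
    by (intro AE_I2) (auto simp: abs_mult intro!: mult_right_mono)
qed

lemma spread_nonneg: "0 \<le> spread R"
  unfolding spread_def by (intro integral_nonneg_AE AE_I2 mult_nonneg_nonneg) (auto simp: nonneg)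

text \<open>Dominated convergence: for \<open>R \<ge> 1\<close> the integrand lies below the one for
  \<open>R = 1\<close>, and it vanishes pointwise in the limit.\<close>

lemma spread_tendsto_0: "(spread \<longlongrightarrow> 0) at_top"
proof -
  have "((\<lambda>R. LINT z|lebesgue. min 1 ((z / R)\<^sup>2) * J z) \<longlongrightarrow> (LINT z|(lebesgue :: real measure). 0)) at_top"
  proof (rule integral_dominated_convergence_at_top[OF _ _ integrable])
    show "(\<lambda>z. min 1 ((z / R)\<^sup>2) * J z) \<in> borel_measurable lebesgue" for R
      using measurable measurable_min_square by (intro borel_measurable_times)
    show "AE z in lebesgue. ((\<lambda>R. min 1 ((z / R)\<^sup>2) * J z) \<longlongrightarrow> 0) at_top"
    proof (rule AE_I2)
      fix z
      have "((\<lambda>R::real. z / R) \<longlongrightarrow> 0) at_top" by (intro real_tendsto_divide_at_top[OF tendsto_const] filterlim_ident)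
      then have "((\<lambda>R. min 1 ((z / R)\<^sup>2) * J z) \<longlongrightarrow> min 1 (0\<^sup>2) * J z) at_top"
        by (intro tendsto_intros)
      then show "((\<lambda>R. min 1 ((z / R)\<^sup>2) * J z) \<longlongrightarrow> 0) at_top" by simp
    qed
    show "\<forall>\<^sub>F R in at_top. AE z in lebesgue. norm (min 1 ((z / R)\<^sup>2) * J z) \<le> min 1 (z\<^sup>2) * J z"
      using eventually_ge_at_top[of 1]
    proof eventually_elim
      case (elim R)
      then show ?case
        using min_square_le[of R] nonneg
        by (intro AE_I2) (auto simp: abs_mult intro!: mult_right_mono)
    qed
  qed simp
  then show ?thesis by (simp add: spread_def[abs_def])
qed

text \<open>For |z| > \<epsilon> the weight \<open>min 1 (z\<^sup>2)\<close> is at least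
  \<open>min 1 (\<epsilon>\<^sup>2)\<close>, so a multiple of the integrable function
  \<open>min 1 (z\<^sup>2) * J z\<close> is a majorant.\<close>

lemma set_integrable_away_from_0:
  assumes "\<epsilon> > 0" and f: "f \<in> borel_measurable lebesgue" and B: "\<And>z. \<bar>f z\<bar> \<le> B"
  shows "set_integrable lebesgue {z. \<bar>z\<bar> > \<epsilon>} (\<lambda>z. f z * J z)"
  unfolding set_integrable_def
proof (rule Bochner_Integration.integrable_bound)
  let ?m = "min 1 (\<epsilon>\<^sup>2)"
  have m: "?m > 0" using assms by simp
  show "integrable lebesgue (\<lambda>z. (B / ?m) * (min 1 (z\<^sup>2) * J z))"
    by (intro integrable_mult_right integrable)
  show "(\<lambda>z. indicator {z. \<bar>z\<bar> > \<epsilon>} z *\<^sub>R (f z * J z)) \<in> borel_measurable lebesgue"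
  proof (intro borel_measurable_scaleR borel_measurable_times f measurable borel_measurable_indicator)
    have "open {z::real. \<bar>z\<bar> > \<epsilon>}" by (intro open_Collect_less continuous_intros)
    then show "{z. \<bar>z\<bar> > \<epsilon>} \<in> sets lebesgue" by auto
  qed
  have "\<bar>f z * J z\<bar> \<le> B / ?m * (min 1 (z\<^sup>2) * J z)" if "\<bar>z\<bar> > \<epsilon>" for z
  proof -
    have "\<epsilon>\<^sup>2 \<le> z\<^sup>2" using that assms abs_le_square_iff[of \<epsilon> z] by simp
    then have *: "1 \<le> min 1 (z\<^sup>2) / ?m" using m by (simp add: min_def)
    have B0: "B \<ge> 0" using B[of 0] by linarith
    have "\<bar>f z * J z\<bar> \<le> B * J z"
      using B[of z] nonneg[of z] by (simp add: abs_mult mult_right_mono)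
    also have "\<dots> \<le> B * J z * (min 1 (z\<^sup>2) / ?m)"
      using mult_left_mono[OF *, of "B * J z"] B0 nonneg[of z] by simp
    finally show ?thesis by (simp add: mult_ac)
  qed
  moreover have "B \<ge> 0" using B[of 0] by linarith
  ultimately show "AE z in lebesgue. norm (indicator {z. \<bar>z\<bar> > \<epsilon>} z *\<^sub>R (f z * J z))
      \<le> norm (B / ?m * (min 1 (z\<^sup>2) * J z))"
    using nonneg m by (intro AE_I2) (force simp: indicator_def)
qed

lemma set_integrable_bump:
  assumes "\<epsilon> > 0" "R > 0"
  shows "set_integrable lebesgue {z. \<bar>z\<bar> > \<epsilon>} (\<lambda>z. (bump c R (x - z) - bump c R x) * J z)"
proof (rule set_integrable_away_from_0[OF assms(1)])
  have "continuous_on UNIV (\<lambda>z. bump c R (x - z) - bump c R x)"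
    by (intro continuous_intros continuous_on_compose2[OF continuous_on_bump[OF assms(2), of UNIV]]) auto
  then show "(\<lambda>z. bump c R (x - z) - bump c R x) \<in> borel_measurable lebesgue"
    by (intro measurable_completion) (auto intro: borel_measurable_continuous_onI)
  show "\<bar>bump c R (x - z) - bump c R x\<bar> \<le> 1" for z
    using bump_nonneg[of c R x] bump_nonneg[of c R "x - z"]
      bump_le_1[of c R x] bump_le_1[of c R "x - z"] by linarith
qed

text \<open>The truncated region and \<open>J\<close> are even, so averaging over z and -z replaces
  first differences by second ones. The bound is free of \<epsilon> and therefore survives the
  principal value limit.\<close>

lemma truncated_diffusion_bump_ge:
  assumes "\<epsilon> > 0" "R \<ge> 1"
  shows "truncated_diffusion J \<epsilon> (bump c R) x \<ge> - spread R"
proof -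
  define f where "f z = indicator {z. \<bar>z\<bar> > \<epsilon>} z *\<^sub>R ((bump c R (x - z) - bump c R x) * J z)" for z
  have f: "integrable lebesgue f"
    using set_integrable_bump[of \<epsilon> R c x] assms unfolding set_integrable_def f_def[abs_def] by simp
  have f': "integrable lebesgue (\<lambda>z. f (- z))"
    using lebesgue_integrable_real_affine[OF f, of "-1" 0] by simp
  have eq: "(LINT z|lebesgue. f (- z)) = (LINT z|lebesgue. f z)"
    using lebesgue_integral_real_affine[of "-1" f 0] by simp
  have "(LINT z|lebesgue. - 2 * (min 1 ((z / R)\<^sup>2) * J z)) \<le> (LINT z|lebesgue. f z + f (- z))"
  proof (intro integral_mono integrable_mult_right integrable_min_square[OF assms(2)]
      Bochner_Integration.integrable_add f f')
    fix z
    have J: "J (- z) = J z" by (rule symmetric)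
    have "- 2 * min 1 ((z / R)\<^sup>2) * J z
      \<le> (bump c R (x - z) + bump c R (x + z) - 2 * bump c R x) * J z"
      using bump_second_difference[of R z c x] assms by (intro mult_right_mono nonneg) auto
    moreover have "0 \<le> min 1 ((z / R)\<^sup>2) * J z" by (simp add: nonneg)
    ultimately show "- 2 * (min 1 ((z / R)\<^sup>2) * J z) \<le> f z + f (- z)"
      by (auto simp: f_def J algebra_simps split: split_indicator)
  qed
  then have "- 2 * spread R \<le> 2 * (LINT z|lebesgue. f z)"
    using eq f f' by (simp add: spread_def)
  then show ?thesis
    by (simp add: truncated_diffusion_def set_lebesgue_integral_def f_def)
qed

text \<open>Integrate \<open>le\<close> against \<open>J\<close> over |z| > \<epsilon>, then let
  \<epsilon> tend to 0; only the bump has to be regular in space. It serves as a test function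
  touching \<open>v\<close> from below at \<open>x\<close>, while the indicator records the gain
  from long jumps.\<close>

lemma diffusion_ge_of_touching:
  assumes v: "diffusion_well_defined J v x"
    and R: "R \<ge> 1" and "P \<ge> 0" "l > 0"
    and le: "\<And>z. P * (bump c R (x - z) - bump c R x) + A * indicator {l..m} z \<le> v (x - z) - v x"
  shows "diffusion J v x \<ge> A * (LINT z:{l..m}|lebesgue. J z) - P * spread R"
proof -
  obtain L where L: "((\<lambda>\<epsilon>. truncated_diffusion J \<epsilon> v x) \<longlongrightarrow> L) (at_right 0)"
    using v by (auto simp: diffusion_well_defined_def)
  then have "diffusion J v x = L"
    unfolding diffusion_def by (intro tendsto_Lim) auto
  moreover have "A * (LINT z:{l..m}|lebesgue. J z) - P * spread R \<le> L"
  proof (rule tendsto_lowerbound[OF L])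
    \<comment> \<open>Once \<epsilon> < l, the truncation no longer cuts into the jump window
      \<open>{l..m}\<close>.\<close>
    have "\<forall>\<^sub>F \<epsilon> in at_right 0. 0 < \<epsilon> \<and> \<epsilon> < l"
      using \<open>l > 0\<close> by (auto simp: eventually_at_right_field)
    then show "\<forall>\<^sub>F \<epsilon> in at_right 0.
        A * (LINT z:{l..m}|lebesgue. J z) - P * spread R \<le> truncated_diffusion J \<epsilon> v x"
    proof eventually_elim
      case (elim \<epsilon>)
      let ?S = "{z. \<bar>z\<bar> > \<epsilon>}"
      let ?f = "\<lambda>z. (bump c R (x - z) - bump c R x) * J z" and ?g = "\<lambda>z. indicator {l..m} z * J z"
      have f: "set_integrable lebesgue ?S ?f"
        using elim R by (intro set_integrable_bump) auto
      have g: "set_integrable lebesgue ?S ?g"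
        using elim by (intro set_integrable_away_from_0[where B = 1] borel_measurable_indicator)
          (auto simp: indicator_def)
      have "(LINT z:{l..m}|lebesgue. J z) = (LINT z:?S|lebesgue. ?g z)"
        unfolding set_lebesgue_integral_def
        using elim by (intro Bochner_Integration.integral_cong) (auto simp: indicator_def)
      then have "A * (LINT z:{l..m}|lebesgue. J z) - P * spread R
          \<le> P * truncated_diffusion J \<epsilon> (bump c R) x + A * (LINT z:?S|lebesgue. ?g z)"
        using mult_left_mono[OF truncated_diffusion_bump_ge[of \<epsilon> R c x] \<open>P \<ge> 0\<close>] elim R by simp
      also have "\<dots> = (LINT z:?S|lebesgue. P * ?f z + A * ?g z)"
        using f g by (simp add: truncated_diffusion_def)
      also have "\<dots> \<le> truncated_diffusion J \<epsilon> v x"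
        unfolding truncated_diffusion_def
      proof (rule set_integral_mono)
        show "set_integrable lebesgue ?S (\<lambda>z. P * ?f z + A * ?g z)" using f g by auto
        show "set_integrable lebesgue ?S (\<lambda>z. (v (x - z) - v x) * J z)"
          using v elim by (auto simp: diffusion_well_defined_def)
        show "P * ?f z + A * ?g z \<le> (v (x - z) - v x) * J z" for z
          using mult_right_mono[OF le[of z] nonneg[of z]] by (simp add: algebra_simps)
      qed
      finally show ?case .
    qed
  qed simp
  ultimately show ?thesis by simp
qed

end

section \<open>Joint continuity and comparison from below\<close>

lemma cont_curve_imp_continuous_on:
  assumes "cont_curve I f" "compact K"
  shows "continuous_on (I \<times> K) (\<lambda>(t, x). f t x)"
  unfolding continuous_on_def
proof safe
  fix t x assume t: "t \<in> I" and x: "x \<in> K"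
  let ?F = "at (t, x) within I \<times> K"
  have ev: "\<forall>\<^sub>F p in ?F. p \<in> I \<times> K \<and> p \<noteq> (t, x)"
    by (simp add: eventually_at_topological) blast
  have lim: "((\<lambda>p. f t (snd p)) \<longlongrightarrow> f t x) ?F"
  proof -
    have "continuous_on UNIV (f t)" using assms t by (auto simp: cont_curve_def)
    then have "isCont (f t) x" by (simp add: continuous_on_eq_continuous_at)
    moreover have "(snd \<longlongrightarrow> x) ?F" by (auto intro!: tendsto_eq_intros)
    ultimately show ?thesis by (rule isCont_tendsto_compose)
  qed
  have "((\<lambda>p. dist (f (fst p) (snd p)) (f t x)) \<longlongrightarrow> 0) ?F"
  proof (rule tendstoI)
    fix e :: real assume e: "e > 0"
    \<comment> \<open>The filter is silent at \<tau> = t, but there the distance is 0, so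
      \<open>close\<close> covers that time as well.\<close>
    have "\<forall>\<^sub>F \<tau> in at t within I. \<forall>y\<in>K. dist (f \<tau> y) (f t y) < e / 2"
      using assms t e half_gt_zero[of e] unfolding cont_curve_def uniform_limit_iff by blast
    then obtain d where d: "d > 0"
      and close: "\<And>\<tau> y. \<tau> \<in> I \<Longrightarrow> dist \<tau> t < d \<Longrightarrow> y \<in> K \<Longrightarrow> dist (f \<tau> y) (f t y) < e / 2"
      using e unfolding eventually_at by (metis dist_self half_gt_zero)
    have "\<forall>\<^sub>F p in ?F. dist (fst p) t < d"
      using d by (intro tendstoD) (auto intro!: tendsto_eq_intros)
    moreover have "\<forall>\<^sub>F p in ?F. dist (f t (snd p)) (f t x) < e / 2"
      using e by (intro tendstoD[OF lim]) simp
    ultimately show "\<forall>\<^sub>F p in ?F. dist (dist (f (fst p) (snd p)) (f t x)) 0 < e"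
      using ev
    proof eventually_elim
      case (elim p)
      then have "dist (f (fst p) (snd p)) (f t (snd p)) < e / 2" by (intro close) auto
      then show ?case
        using elim dist_triangle[of "f (fst p) (snd p)" "f t x" "f t (snd p)"] by (simp add: dist_commute)
    qed
  qed
  then show "((\<lambda>(t, x). f t x) \<longlongrightarrow> f t x) ?F"
    unfolding case_prod_beta by (subst tendsto_dist_iff) simp
qed

text \<open>At a negative minimum of \<open>u\<close> minus the barrier, the equation gives
  diffusion at most \<open>q - r\<close>. Touching gives at least the influx from jumps landing
  where \<open>left\<close> applies, minus the loss \<open>(p + q * T) * spread R\<close>. The
  strict inequality \<open>rate\<close> makes the two incompatible, so no perturbation of the
  barrier is required.\<close>

lemma (in levy_kernel) comparison:
  assumes sol: "diffusion_solution J u0 u"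
    and pos: "\<And>t y. t \<ge> 0 \<Longrightarrow> u t y \<ge> 0"
    and pqr: "p \<ge> 0" "q \<ge> 0" "r \<ge> 0" and R: "R \<ge> 1" and "l > 0"
    and init: "\<And>y. p * bump c R y \<le> u0 y"
    and left: "\<And>t y. 0 \<le> t \<Longrightarrow> t \<le> T \<Longrightarrow> y \<le> c + R - l \<Longrightarrow> A \<le> u t y"
    and l: "2 * R \<le> l"
    and rate: "q + (p + q * T) * spread R < r + A * (LINT z:{l..m}|lebesgue. J z)"
    and t: "0 \<le> t" "t \<le> T"
  shows "(p + q * t) * bump c R y - r * t \<le> u t y"
proof (rule ccontr)
  define w where "w t y = (p + q * t) * bump c R y - r * t" for t y
  \<comment> \<open>\<open>K\<close> is the support of the bump. Off \<open>K\<close> the barrier is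
    at most 0 while \<open>u\<close> is nonnegative, so a negative minimum over
    \<open>{0..T} \<times> K\<close> is a minimum over the whole strip.\<close>
  define K where "K = {c - R..c + R}"
  have w_outside: "w t y \<le> 0" if "t \<ge> 0" "y \<notin> K" for t y
    using that R pqr bump_eq_0[of R y c] by (auto simp: w_def K_def)
  assume "\<not> ?thesis"
  then have neg: "u t y - w t y < 0" by (simp add: w_def)
  then have yK: "y \<in> K" using w_outside[of t y] pos[of t y] t by force
  have "continuous_on ({0..} \<times> K) (\<lambda>(t, x). u t x)"
    using sol by (intro cont_curve_imp_continuous_on) (auto simp: diffusion_solution_def K_def)
  then have "continuous_on ({0..T} \<times> K) (\<lambda>(t, x). u t x)"
    by (rule continuous_on_subset) auto
  moreover have "continuous_on ({0..T} \<times> K) (\<lambda>(t, x). w t x)"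
    unfolding w_def case_prod_beta using R
    by (intro continuous_intros continuous_on_compose2[OF continuous_on_bump[of R UNIV c]]) auto
  ultimately have "continuous_on ({0..T} \<times> K) (\<lambda>x. u (fst x) (snd x) - w (fst x) (snd x))"
    by (intro continuous_intros) (simp_all add: case_prod_beta)
  moreover have "compact ({0..T} \<times> K)" "{0..T} \<times> K \<noteq> {}"
    using t yK by (auto simp: K_def intro!: compact_Times)
  ultimately obtain P where P: "P \<in> {0..T} \<times> K"
    "\<And>Q. Q \<in> {0..T} \<times> K \<Longrightarrow> u (fst P) (snd P) - w (fst P) (snd P) \<le> u (fst Q) (snd Q) - w (fst Q) (snd Q)"
    using continuous_attains_inf[of "{0..T} \<times> K"] by blast
  define \<tau> x where "\<tau> = fst P" and "x = snd P"
  have \<tau>: "0 \<le> \<tau>" "\<tau> \<le> T" and xK: "x \<in> K" using P by (auto simp: \<tau>_def x_def)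
  have min_K: "u \<tau> x - w \<tau> x \<le> u t' y' - w t' y'" if "0 \<le> t'" "t' \<le> T" "y' \<in> K" for t' y'
    using P(2)[of "(t', y')"] that by (simp add: \<tau>_def x_def)
  have neg_min: "u \<tau> x - w \<tau> x < 0" using min_K[of t y] neg t yK by linarith
  have min: "u \<tau> x - w \<tau> x \<le> u t' y' - w t' y'" if "0 \<le> t'" "t' \<le> T" for t' y'
    using min_K[of t' y'] w_outside[of t' y'] pos[of t' y'] neg_min that by (cases "y' \<in> K") auto
  have "\<tau> \<noteq> 0"
  proof
    assume "\<tau> = 0"
    moreover have "u 0 x = u0 x" using sol by (auto simp: diffusion_solution_def)
    ultimately show False using neg_min init[of x] by (simp add: w_def)
  qed
  then have "\<tau> > 0" using \<tau> by simp
  have wd: "diffusion_well_defined J (u \<tau>) x"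
    and der: "((\<lambda>t. u t x) has_real_derivative diffusion J (u \<tau>) x) (at \<tau>)"
    using sol \<open>\<tau> > 0\<close> by (auto simp: diffusion_solution_def)
  have D: "((\<lambda>t. u t x - w t x) has_real_derivative (diffusion J (u \<tau>) x - (q * bump c R x - r))) (at \<tau>)"
    unfolding w_def by (auto intro!: derivative_eq_intros der)
  \<comment> \<open>Since \<tau> may equal \<open>T\<close>, minimality is tested against earlier
    times only; this yields the one sign that is required.\<close>
  have "diffusion J (u \<tau>) x - (q * bump c R x - r) \<le> 0"
  proof (rule ccontr)
    assume "\<not> ?thesis"
    then obtain h where h: "h > 0" "\<And>k. 0 < k \<Longrightarrow> k < h \<Longrightarrow> u (\<tau> - k) x - w (\<tau> - k) x < u \<tau> x - w \<tau> x"
      using DERIV_pos_inc_left[OF D] by auto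
    define k where "k = min (h / 2) \<tau>"
    have "0 < k" "k < h" "k \<le> \<tau>" using h \<open>\<tau> > 0\<close> by (auto simp: k_def)
    then show False using h(2)[of k] min[of "\<tau> - k" x] \<tau> by auto
  qed
  moreover have "q * bump c R x \<le> q"
    using mult_left_mono[OF bump_le_1[of c R x], of q] pqr by simp
  ultimately have upper: "diffusion J (u \<tau>) x \<le> q - r" by linarith
  have "diffusion J (u \<tau>) x \<ge> A * (LINT z:{l..m}|lebesgue. J z) - (p + q * \<tau>) * spread R"
  proof (rule diffusion_ge_of_touching[OF wd R _ \<open>l > 0\<close>])
    show "0 \<le> p + q * \<tau>" using pqr \<tau> by simp
    fix z
    show "(p + q * \<tau>) * (bump c R (x - z) - bump c R x) + A * indicator {l..m} z \<le> u \<tau> (x - z) - u \<tau> x"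
    proof (cases "z \<in> {l..m}")
      case True
      \<comment> \<open>A jump of length at least \<open>2 * R\<close> from a point of the support
        lands where the bump vanishes and \<open>u\<close> is at least \<open>A\<close>. Negativity
        of the minimum bounds \<open>u \<tau> x\<close> by
        \<open>(p + q * \<tau>) * bump c R x\<close>.\<close>
      then have z: "x - z \<le> c + R - l" using xK by (auto simp: K_def)
      then have "bump c R (x - z) = 0" using l R by (intro bump_eq_0) auto
      then show ?thesis
        using left[OF \<tau> z] True neg_min mult_nonneg_nonneg[OF pqr(3) \<tau>(1)]
        by (simp add: w_def)
    next
      case False
      then show ?thesis using min[OF \<tau>, of "x - z"] by (simp add: w_def algebra_simps)
    qed
  qed
  moreover have "(p + q * \<tau>) * spread R \<le> (p + q * T) * spread R"
    using pqr \<tau> by (intro mult_right_mono add_left_mono mult_left_mono spread_nonneg)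
  ultimately show False using upper rate by linarith
qed

section \<open>Admissible kernels: Levy integrability and tail mass\<close>

lemma admissible_kernel_imp_levy_kernel:
  assumes "s > 0" "admissible_kernel s J"
  shows "levy_kernel J"
proof
  obtain J0 J1 where J: "J \<in> borel_measurable lebesgue" "\<And>z. 0 \<le> J z" "\<And>z. J (- z) = J z"
    and J0: "J0 > 0"
    and near: "(\<integral>\<^sup>+z\<in>{z. \<bar>z\<bar> \<le> 1}. ennreal (J z * \<bar>z\<bar>\<^sup>2) \<partial>lebesgue) \<le> ennreal (2 * J1)"
    and far: "\<And>z. z \<noteq> 0 \<Longrightarrow> J z * indicator {z. \<bar>z\<bar> > 1} z \<le> J0 / \<bar>z\<bar> powr (1 + 2 * s)"
    using assms(2) unfolding admissible_kernel_def by blast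
  show "J \<in> borel_measurable lebesgue" "\<And>z. 0 \<le> J z" "\<And>z. J (- z) = J z" by fact+
  have sets: "{z::real. \<bar>z\<bar> \<le> 1} \<in> sets lebesgue" "{z::real. \<bar>z\<bar> > 1} \<in> sets lebesgue"
    by (auto intro!: borel_closed borel_open closed_Collect_le open_Collect_less continuous_intros)
  have sq: "(\<lambda>z::real. z\<^sup>2) \<in> borel_measurable lebesgue"
    "(\<lambda>z::real. min 1 (z\<^sup>2)) \<in> borel_measurable lebesgue"
    by (rule measurable_completion, simp)+
  have near': "integrable lebesgue (\<lambda>z. indicator {z. \<bar>z\<bar> \<le> 1} z * (J z * z\<^sup>2))"
  proof (rule integrableI_nonneg)
    show "(\<lambda>z. indicator {z. \<bar>z\<bar> \<le> 1} z * (J z * z\<^sup>2)) \<in> borel_measurable lebesgue"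
      by (intro borel_measurable_times J sq borel_measurable_indicator sets)
    show "AE z in lebesgue. 0 \<le> indicator {z. \<bar>z\<bar> \<le> 1} z * (J z * z\<^sup>2)"
      by (intro AE_I2) (simp add: J)
    have "(\<integral>\<^sup>+z. ennreal (indicator {z. \<bar>z\<bar> \<le> 1} z * (J z * z\<^sup>2)) \<partial>lebesgue)
        = (\<integral>\<^sup>+z\<in>{z. \<bar>z\<bar> \<le> 1}. ennreal (J z * \<bar>z\<bar>\<^sup>2) \<partial>lebesgue)"
      by (intro nn_integral_cong) (auto split: split_indicator)
    also have "\<dots> < \<infinity>" using near by (simp add: le_less_trans ennreal_less_top)
    finally show "(\<integral>\<^sup>+z. ennreal (indicator {z. \<bar>z\<bar> \<le> 1} z * (J z * z\<^sup>2)) \<partial>lebesgue) < \<infinity>" .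
  qed
  \<comment> \<open>A one-sided power tail, integrable because s > 0. Added to its reflection and
    multiplied by \<open>J0\<close>, it majorizes \<open>J\<close> on |z| > 1.\<close>
  define g where "g z = indicator {1..} z *\<^sub>R (z powr (-1 - 2 * s))" for z :: real
  have "(\<lambda>z::real. z powr (-1 - 2 * s)) integrable_on {1..}"
    using has_integral_powr_to_inf[of "-1 - 2 * s" 1] assms(1) by (auto simp: integrable_on_def)
  then have g: "integrable lebesgue g"
    using nonnegative_absolutely_integrable_1[of "\<lambda>z. z powr (-1 - 2 * s)" "{1..}"]
    unfolding set_integrable_def g_def[abs_def] by simp
  then have g': "integrable lebesgue (\<lambda>z. g (- z))"
    using lebesgue_integrable_real_affine[OF g, of "-1" 0] by simp
  have far': "integrable lebesgue (\<lambda>z. indicator {z. \<bar>z\<bar> > 1} z * J z)"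
  proof (rule Bochner_Integration.integrable_bound)
    show "integrable lebesgue (\<lambda>z. J0 * (g z + g (- z)))" using g g' by simp
    show "(\<lambda>z. indicator {z. \<bar>z\<bar> > 1} z * J z) \<in> borel_measurable lebesgue"
      by (intro borel_measurable_times J borel_measurable_indicator sets)
    have "\<bar>indicator {z. \<bar>z\<bar> > 1} z * J z\<bar> \<le> \<bar>J0 * (g z + g (- z))\<bar>" for z
    proof (cases "\<bar>z\<bar> > 1")
      case True
      then have "J z \<le> J0 * \<bar>z\<bar> powr (-1 - 2 * s)"
        using far[of z] powr_minus_divide[of "\<bar>z\<bar>" "1 + 2 * s"] by auto
      moreover have "g z + g (- z) = \<bar>z\<bar> powr (-1 - 2 * s)"
        using True by (auto simp: g_def indicator_def)
      ultimately show ?thesis using True J(2)[of z] by simp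
    qed simp
    then show "AE z in lebesgue. norm (indicator {z. \<bar>z\<bar> > 1} z * J z) \<le> norm (J0 * (g z + g (- z)))"
      by simp
  qed
  have "min 1 (z\<^sup>2) * J z = indicator {z. \<bar>z\<bar> \<le> 1} z * (J z * z\<^sup>2) + indicator {z. \<bar>z\<bar> > 1} z * J z" for z
    using abs_square_le_1[of z] by (auto simp: indicator_def min_def not_le)
  then show "integrable lebesgue (\<lambda>z. min 1 (z\<^sup>2) * J z)" using near' far' by simp
qed

text \<open>On this interval of length \<open>X\<close> the lower power bound for \<open>J\<close>
  is smallest at the right end; length times that value has order
  \<open>X powr (- 2 * s)\<close>.\<close>

lemma admissible_kernel_tail_integral:
  assumes "s > 0" "admissible_kernel s J"
  obtains k M where "k > 0" "M \<ge> 1" "\<And>X. X \<ge> M \<Longrightarrow> (LINT z:{X..2 * X}|lebesgue. J z) \<ge> k * X powr (- 2 * s)"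
proof -
  interpret levy_kernel J using assms by (rule admissible_kernel_imp_levy_kernel)
  obtain J0 R0 where J0: "J0 > 0" and R0: "R0 > 1"
    and far: "\<And>z. z \<noteq> 0 \<Longrightarrow> inverse J0 / \<bar>z\<bar> powr (1 + 2 * s) * indicator {z. \<bar>z\<bar> \<ge> R0} z
             \<le> J z * indicator {z. \<bar>z\<bar> > 1} z"
    using assms(2) unfolding admissible_kernel_def by blast
  show ?thesis
  proof (rule that)
    show "inverse J0 * 2 powr (-1 - 2 * s) > 0" using J0 by simp
    show "R0 \<ge> 1" using R0 by simp
    fix X assume X: "X \<ge> R0"
    have "inverse J0 * 2 powr (-1 - 2 * s) * X powr (- 2 * s)
        = (inverse J0 * (2 * X) powr (-1 - 2 * s)) * X"
      using X R0 powr_add[of X "-1 - 2 * s" 1] by (simp add: powr_mult mult_ac)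
    also have "\<dots> = (LINT z:{X..2 * X}|lebesgue. inverse J0 * (2 * X) powr (-1 - 2 * s))"
      using X R0 by (subst set_integral_const) (auto simp: mult_ac)
    also have "\<dots> \<le> (LINT z:{X..2 * X}|lebesgue. J z)"
    proof (rule set_integral_mono)
      show "set_integrable lebesgue {X..2 * X} (\<lambda>z. inverse J0 * (2 * X) powr (-1 - 2 * s))"
        using absolutely_integrable_on_const[of "{X..2 * X}"] by simp
      have "set_integrable lebesgue {z. \<bar>z\<bar> > 1 / 2} J"
        using set_integrable_away_from_0[of "1 / 2" "\<lambda>_. 1" 1] by simp
      then show "set_integrable lebesgue {X..2 * X} J"
        by (rule set_integrable_subset) (use X R0 in auto)
      fix z assume z: "z \<in> {X..2 * X}"
      have "(2 * X) powr (-1 - 2 * s) \<le> z powr (-1 - 2 * s)"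
        using z X R0 assms(1) by (intro powr_mono2') auto
      then have "inverse J0 * (2 * X) powr (-1 - 2 * s) \<le> inverse J0 * z powr (-1 - 2 * s)"
        using J0 by (intro mult_left_mono) auto
      also have "\<dots> \<le> J z"
        using far[of z] z X R0 powr_minus_divide[of z "1 + 2 * s"] by (simp add: divide_inverse powr_minus)
      finally show "inverse J0 * (2 * X) powr (-1 - 2 * s) \<le> J z" .
    qed
    finally show "inverse J0 * 2 powr (-1 - 2 * s) * X powr (- 2 * s) \<le> (LINT z:{X..2 * X}|lebesgue. J z)" .
  qed
qed

section \<open>The lower bound at distant points\<close>

theorem theorem1p3:
  fixes s :: real and J u0 :: "real \<Rightarrow> real"
  assumes "s > 0"
    and "admissible_kernel s J"
    and "\<forall>x. u0 x \<ge> 0"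
    and "continuous_on UNIV u0"
    and "bounded (range u0)"
    and "\<exists>a>0. \<exists>b. \<forall>x. u0 x \<ge> a * indicator {..b} x"
  shows "\<exists>\<kappa>>0. \<forall>u. positive_solution J u0 u \<longrightarrow>
           (\<forall>t>0. Liminf at_top (\<lambda>x. ereal (x powr (2 * s) * u t x)) \<ge> ereal (\<kappa> * t))"
proof -
  interpret levy_kernel J using assms(1,2) by (rule admissible_kernel_imp_levy_kernel)
  obtain k M where "k > 0" and M: "M \<ge> 1"
    and tail: "\<And>X. X \<ge> M \<Longrightarrow> (LINT z:{X..2 * X}|lebesgue. J z) \<ge> k * X powr (- 2 * s)"
    using admissible_kernel_tail_integral[OF assms(1,2)] by blast
  obtain a b where "a > 0" and ab: "\<And>x. u0 x \<ge> a * indicator {..b} x" using assms(6) by blast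
  \<comment> \<open>The influx at a distant \<open>X\<close> is at least the height
    \<open>a / 2\<close> times the tail mass \<open>k * (2 * X) powr (- 2 * s)\<close>. The growth
    rate \<open>\<kappa> * X powr (- 2 * s)\<close> is half of this product, which leaves room for
    the loss. \<open>\<kappa>\<close> is fixed before \<open>u\<close> and \<open>T\<close>.\<close>
  define \<kappa> where "\<kappa> = a / 4 * k * 2 powr (- 2 * s)"
  have "\<kappa> > 0" using \<open>a > 0\<close> \<open>k > 0\<close> by (simp add: \<kappa>_def)
  moreover have "Liminf at_top (\<lambda>x. ereal (x powr (2 * s) * u T x)) \<ge> ereal (\<kappa> * T)"
    if u: "positive_solution J u0 u" and "T > 0" for u T
  proof (rule Liminf_bounded)
    have sol: "diffusion_solution J u0 u" using u by (simp add: positive_solution_def)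
    have pos: "u t y \<ge> 0" if "t \<ge> 0" for t y
      using u assms(3) that by (cases "t = 0")
        (auto simp: positive_solution_def diffusion_solution_def less_imp_le)
    \<comment> \<open>The loss accumulated up to time \<open>T\<close> then stays below half the
      height of a bump. \<open>R\<close> depends on \<open>T\<close>, but it affects only how far
      out \<open>X\<close> must lie.\<close>
    have "\<forall>\<^sub>F R in at_top. spread R < 1 / (2 * T) \<and> R \<ge> 1"
      using order_tendstoD(2)[OF spread_tendsto_0, of "1 / (2 * T)"] \<open>T > 0\<close> eventually_ge_at_top[of 1]
      by (auto intro: eventually_conj)
    then obtain R where R: "spread R < 1 / (2 * T)" "R \<ge> 1"
      by (auto simp: eventually_at_top_linorder)
    have left: "a / 2 \<le> u t y" if t: "0 \<le> t" "t \<le> T" and y: "y \<le> b - R" for t y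
    proof -
      \<comment> \<open>The bump of height \<open>a\<close> fits under \<open>u0\<close>, its
        support lying in \<open>{..b}\<close>. Lowering it at rate \<open>a / (2 * T)\<close>
        outweighs the loss \<open>a * spread R\<close> and costs at most \<open>a / 2\<close> in
        all. \<open>A = 0\<close> turns the premise on the half line into nonnegativity of
        \<open>u\<close>, so the jump window may be any.\<close>
      have "(a + 0 * t) * bump y R y - a / (2 * T) * t \<le> u t y"
      proof (rule comparison[where l = "2 * R" and m = "2 * R" and A = 0, OF sol pos])
        fix x
        have "bump y R x \<le> indicator {..b} x"
          using bump_eq_0[of R x y] bump_le_1[of y R x] y R by (auto simp: indicator_def)
        then have "a * bump y R x \<le> a * indicator {..b} x"
          using \<open>a > 0\<close> by (intro mult_left_mono) auto
        then show "a * bump y R x \<le> u0 x" using ab[of x] by linarith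
      next
        show "0 + (a + 0 * T) * spread R < a / (2 * T) + 0 * (LINT z:{2 * R..2 * R}|lebesgue. J z)"
          using mult_strict_left_mono[OF R(1) \<open>a > 0\<close>] by simp
      qed (use t R \<open>a > 0\<close> \<open>T > 0\<close> pos in auto)
      moreover have "a / (2 * T) * t \<le> a / (2 * T) * T"
        using t \<open>a > 0\<close> \<open>T > 0\<close> by (intro mult_left_mono) auto
      moreover have "a / (2 * T) * T = a / 2" using \<open>T > 0\<close> by simp
      ultimately show ?thesis by simp
    qed
    \<comment> \<open>\<open>M\<close> admits the tail bound at \<open>2 * X\<close>;
      \<open>2 * R\<close> makes jumps of length \<open>2 * X\<close> leave the support;
      \<open>2 * R - b\<close> puts the landing points, at most \<open>R - X\<close>, into the half
      line of \<open>left\<close>.\<close>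
    have "\<forall>\<^sub>F X in at_top. X \<ge> max M (max (2 * R) (2 * R - b))" by (rule eventually_ge_at_top)
    then show "\<forall>\<^sub>F X in at_top. ereal (\<kappa> * T) \<le> ereal (X powr (2 * s) * u T X)"
    proof eventually_elim
      case (elim X)
      define q where "q = \<kappa> * X powr (- 2 * s)"
      have X: "X > 0" using elim M by auto
      then have "q > 0" using \<open>\<kappa> > 0\<close> by (simp add: q_def)
      \<comment> \<open>This barrier starts from 0 and is fed by jumps of length between
        \<open>2 * X\<close> and \<open>4 * X\<close>. Growth \<open>q\<close> plus a loss below
        \<open>q / 2\<close> stays under the influx of at least \<open>2 * q\<close>.\<close>
      have "(0 + q * T) * bump X R X - 0 * T \<le> u T X"
      proof (rule comparison[where l = "2 * X" and m = "2 * (2 * X)" and A = "a / 2", OF sol pos])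
        have "2 * q = a / 2 * (k * (2 * X) powr (- 2 * s))"
          using X by (simp add: q_def \<kappa>_def powr_mult)
        also have "\<dots> \<le> a / 2 * (LINT z:{2 * X..2 * (2 * X)}|lebesgue. J z)"
          using elim X \<open>a > 0\<close> by (intro mult_left_mono tail) auto
        finally have 1: "2 * q \<le> a / 2 * (LINT z:{2 * X..2 * (2 * X)}|lebesgue. J z)" .
        have "(0 + q * T) * spread R < q * T * (1 / (2 * T))"
          using mult_strict_left_mono[OF R(1), of "q * T"] \<open>q > 0\<close> \<open>T > 0\<close> by simp
        also have "\<dots> = q / 2" using \<open>T > 0\<close> by simp
        finally show "q + (0 + q * T) * spread R < 0 + a / 2 * (LINT z:{2 * X..2 * (2 * X)}|lebesgue. J z)"
          using 1 \<open>q > 0\<close> by linarith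
        show "a / 2 \<le> u t y" if "0 \<le> t" "t \<le> T" "y \<le> X + R - 2 * X" for t y
          using that elim by (intro left) auto
      qed (use elim X R \<open>q > 0\<close> \<open>T > 0\<close> assms(3) in auto)
      then have "q * T \<le> u T X" by simp
      then have "X powr (2 * s) * (q * T) \<le> X powr (2 * s) * u T X"
        by (intro mult_left_mono) auto
      moreover have "X powr (2 * s) * (q * T) = \<kappa> * T"
        using X by (simp add: q_def powr_minus field_simps)
      ultimately show ?case by simp
    qed
  qed
  ultimately show ?thesis by blast
qed

end
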